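(* Assume the Open Coloring Axiom (OCA). Let $\kappa\le2^\omega$, $M$, $(K_\xi)_{\xi<\kappa}$, $\{r_\xi:\xi<\kappa\}$ and splitting functions $f_\xi:M\setminus\{r_\xi\}\to K_\xi$ be as in the definition of a split $M$, and let $K$ be the split $M$ induced by $(f_\xi)_{\xi<\kappa}$. If $K$ is nonmetrizable, then $K$ has a closed subspace admitting a continuous surjection onto a nonmetrizable totally disconnected compact space.
   Context: OCA: for every $X\subseteq\mathbb R$ and every partition $[X]^2=K_0\cup K_1$ with $K_0$ open (in the product topology on $X\times X$), either there is an uncountable $Y\subseteq X$ with $[Y]^2\subseteq K_0$, or $X=\bigcup_{n\in\mathbb N}X_n$ with $[X_n]^2\subseteq K_1$ for all $n$. Split $M$ (definition). Let $\kappa\le 2^\omega$ be a cardinal, $M$ a compact Hausdorff metrizable space with no isolated points, $K_\xi$ ($\xi<\kappa$) compact Hausdorff metrizable spaces, $\{r_\xi:\xi<\kappa\}$ distinct points of $M$, and for each $\xi<\kappa$ let $f_\xi:M\setminus\{r_\xi\}\to K_\xi$ be a continuous function ("splitting function") such that $f_\xi[U\setminus\{r_\xi\}]$ is dense in $K_\xi$ for every open neighbourhood $U$ of $r_\xi$ in $M$. The split $M$ induced by $(f_\xi)_{\xi<\kappa}$ is the subspace $K$ of $M^{\{*\}}\times\prod_{\xi<\kappa}K_\xi$ consisting of the points $x_{\xi,t}$ ($\xi<\kappa$, $t\in K_\xi$) with $x_{\xi,t}( * )=r_\xi$, $x_{\xi,t}(\xi)=t$, $x_{\xi,t}(\eta)=f_\eta(r_\xi)$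 for $\eta\ne\xi$, and the points $x_r$ ($r\in M\setminus\{r_\xi:\xi<\kappa\}$) with $x_r( * )=r$, $x_r(\xi)=f_\xi(r)$ for all $\xi<\kappa$. *)

theory Defs
  imports "HOL-Analysis.Analysis" "HOL-Library.Equipollence"
begin

text \<open>Unordered pairs of distinct elements of X, i.e. [X]^2.\<close>
definition pairs2 :: "'a set \<Rightarrow> 'a set set" where
  "pairs2 X = {{x, y} | x y. x \<in> X \<and> y \<in> X \<and> x \<noteq> y}"

text \<open>Open Colouring Axiom. A colouring [X]^2 = K0 \<union> K1 is given by K0 \<subseteq> [X]^2
  (with K1 = [X]^2 - K0); K0 is open when the symmetric set of ordered pairs
  {(x,y) : {x,y} \<in> K0} is open in X \<times> X.\<close>
definition OCA :: bool where
  "OCA \<longleftrightarrow>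
    (\<forall>(X :: real set) (K0 :: real set set).
       K0 \<subseteq> pairs2 X \<and>
       openin (top_of_set (X \<times> X)) {(x, y). x \<in> X \<and> y \<in> X \<and> {x, y} \<in> K0}
       \<longrightarrow> (\<exists>Y \<subseteq> X. uncountable Y \<and> pairs2 Y \<subseteq> K0)
         \<or> (\<exists>Xn :: nat \<Rightarrow> real set. X = (\<Union>n. Xn n) \<and>
               (\<forall>n. pairs2 (Xn n) \<subseteq> pairs2 X - K0)))"

definition totally_disconnected_space :: "'a topology \<Rightarrow> bool" where
  "totally_disconnected_space X \<longleftrightarrow>
     (\<forall>S. connectedin X S \<longrightarrow> (\<exists>a. S \<subseteq> {a}))"

text \<open>Standing hypotheses of the definition of a split M.\<close>
definition split_data ::
  "'i set \<Rightarrow> 'a topology \<Rightarrow> ('i \<Rightarrow> 'b topology) \<Rightarrow> ('i \<Rightarrow> 'a) \<Rightarrow> ('i \<Rightarrow> 'a \<Rightarrow> 'b) \<Rightarrow> bool"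
where
  "split_data I M Ks r f \<longleftrightarrow>
     I \<lesssim> (UNIV :: real set) \<and>
     compact_space M \<and> Hausdorff_space M \<and> metrizable_space M \<and>
     (\<forall>x \<in> topspace M. \<not> openin M {x}) \<and>
     (\<forall>\<xi> \<in> I. compact_space (Ks \<xi>) \<and> Hausdorff_space (Ks \<xi>) \<and> metrizable_space (Ks \<xi>)) \<and>
     r ` I \<subseteq> topspace M \<and> inj_on r I \<and>
     (\<forall>\<xi> \<in> I. continuous_map (subtopology M (topspace M - {r \<xi>})) (Ks \<xi>) (f \<xi>)) \<and>
     (\<forall>\<xi> \<in> I. \<forall>U. openin M U \<and> r \<xi> \<in> U \<longrightarrow>
         (Ks \<xi>) closure_of (f \<xi> ` (U - {r \<xi>})) = topspace (Ks \<xi>))"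

text \<open>Points of the split M, as elements of M^{*} \<times> \<Prod>_{\<xi>\<in>I} K_\<xi>
  (the product component is an extensional function on I).\<close>
definition split_points ::
  "'i set \<Rightarrow> 'a topology \<Rightarrow> ('i \<Rightarrow> 'b topology) \<Rightarrow> ('i \<Rightarrow> 'a) \<Rightarrow> ('i \<Rightarrow> 'a \<Rightarrow> 'b)
    \<Rightarrow> ('a \<times> ('i \<Rightarrow> 'b)) set"
where
  "split_points I M Ks r f =
     {(r \<xi>, restrict (\<lambda>\<eta>. if \<eta> = \<xi> then t else f \<eta> (r \<xi>)) I) | \<xi> t.
         \<xi> \<in> I \<and> t \<in> topspace (Ks \<xi>)}
   \<union> {(x, restrict (\<lambda>\<eta>. f \<eta> x) I) | x. x \<in> topspace M - r ` I}"

definition split_space ::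
  "'i set \<Rightarrow> 'a topology \<Rightarrow> ('i \<Rightarrow> 'b topology) \<Rightarrow> ('i \<Rightarrow> 'a) \<Rightarrow> ('i \<Rightarrow> 'a \<Rightarrow> 'b)
    \<Rightarrow> ('a \<times> ('i \<Rightarrow> 'b)) topology"
where
  "split_space I M Ks r f =
     subtopology (prod_topology M (product_topology Ks I)) (split_points I M Ks r f)"

end

theory Submission
  imports Defs
begin

text \<open>Nonmetrizability forces uncountably many \<open>K\<^sub>\<xi>\<close> to have two points; Urysohn functions on them
  turn the splitting functions into real functions \<open>g\<^sub>\<xi>\<close> on \<open>M - {r\<^sub>\<xi>}\<close>.  For an interval
  \<open>[a,b]\<close> inside \<open>(0,1)\<close>, colour a pair \<open>{\<xi>,\<eta>}\<close> according to whether both values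
  \<open>g\<^sub>\<eta>(r\<^sub>\<xi>)\<close> and \<open>g\<^sub>\<xi>(r\<^sub>\<eta>)\<close> avoid \<open>[a,b]\<close>.  Two values cannot meet three disjoint intervals,
  so three successive applications of OCA yield an uncountable \<open>Y\<close> and one interval \<open>[a,b]\<close>
  avoided by all values \<open>g\<^sub>\<eta>(r\<^sub>\<xi>)\<close> with \<open>\<xi> \<noteq> \<eta>\<close> in \<open>Y\<close>.  On the closed set of points of
  the split whose \<open>Y\<close>-coordinates avoid \<open>(a,b)\<close>, being above or below the gap is a continuous
  map to \<open>{0,1}\<^sup>Y\<close>; its image is nonmetrizable, because for each \<open>\<xi>\<close> in \<open>Y\<close> it has
  two points that differ exactly at \<open>\<xi>\<close>.\<close>

section \<open>Coding by reals, and OCA for colourings by countably many rectangles\<close>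

text \<open>Up to the factor 3/2 this is the usual embedding of
  \<open>nat \<Rightarrow> bool\<close> onto the ternary Cantor set. Base 3 rather than 2 keeps a
  tail of digits from compensating for an earlier digit.\<close>

definition cantor_code :: "(nat \<Rightarrow> bool) \<Rightarrow> real" where
  "cantor_code s = (\<Sum>n. of_bool (s n) / 3 ^ n)"

lemma summable_power_third: "summable (\<lambda>n. 1 / 3 ^ n :: real)"
  using summable_geometric[of "1/3 :: real"] by (simp add: power_one_over)

lemma suminf_power_third: "(\<Sum>n. 1 / 3 ^ n :: real) = 3 / 2"
  using suminf_geometric[of "1/3 :: real"] by (simp add: power_one_over)

text \<open>The first index \<open>m\<close> \<le> \<open>n\<close> where the sequences differ
  contributes 1/3^m, and all later digits together can cancel at most half of that. Thus each digit
  can be read off from the code with a precision that depends only on its position.\<close>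

lemma cantor_code_dist:
  assumes "s n \<noteq> t n"
  shows "1 / (2 * 3 ^ n) \<le> \<bar>cantor_code s - cantor_code t\<bar>"
proof -
  define m where "m = (LEAST k. s k \<noteq> t k)"
  have m: "s m \<noteq> t m" and mn: "m \<le> n"
    unfolding m_def using assms by (rule LeastI, rule Least_le)
  have less: "s k = t k" if "k < m" for k
    using not_less_Least[of k "\<lambda>k. s k \<noteq> t k"] that unfolding m_def by blast
  define d :: "nat \<Rightarrow> real" where "d = (\<lambda>k. of_bool (s k) / 3 ^ k - of_bool (t k) / 3 ^ k)"
  have sum: "summable (\<lambda>k. of_bool (u k) / 3 ^ k :: real)" for u
    by (rule summable_comparison_test'[OF summable_power_third, of 0]) simp
  have diff: "cantor_code s - cantor_code t = (\<Sum>k. d k)"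
    unfolding cantor_code_def d_def by (intro suminf_diff sum)
  have sd: "summable d"
    unfolding d_def by (intro summable_diff sum)
  have nd: "norm (d k) \<le> 1 / 3 ^ k" for k
    by (simp add: d_def)
  have "(\<Sum>k<Suc m. d k) = d m"
    by (simp add: d_def less)
  then have split: "(\<Sum>k. d k) = (\<Sum>k. d (k + Suc m)) + d m"
    using suminf_split_initial_segment[OF sd, of "Suc m"] by simp
  have dm: "\<bar>d m\<bar> = 1 / 3 ^ m"
    using m by (auto simp: d_def)
  have st: "summable (\<lambda>k. 1 / 3 ^ (k + Suc m) :: real)"
    using summable_power_third by (rule summable_ignore_initial_segment)
  \<comment> \<open>The tail after position \<open>m\<close> is bounded by the geometric series
    (3/2) / 3^(m+1) = 1 / (2 * 3^m).\<close>
  have "norm (\<Sum>k. d (k + Suc m)) \<le> (\<Sum>k. 1 / 3 ^ (k + Suc m))"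
    by (rule norm_suminf_le[OF nd st])
  also have "\<dots> = (\<Sum>k. (1 / 3 ^ k) * (1 / 3 ^ Suc m))"
    by (simp add: power_add mult_ac)
  also have "\<dots> = (\<Sum>k. 1 / 3 ^ k) * (1 / 3 ^ Suc m)"
    by (rule suminf_mult2[OF summable_power_third, symmetric])
  also have "\<dots> = 1 / (2 * 3 ^ m)"
    by (simp add: suminf_power_third)
  finally have "\<bar>\<Sum>k. d (k + Suc m)\<bar> \<le> 1 / (2 * 3 ^ m)"
    by simp
  then have "1 / 3 ^ m - 1 / (2 * 3 ^ m) \<le> \<bar>cantor_code s - cantor_code t\<bar>"
    using dm unfolding diff split by linarith
  moreover have "1 / (2 * 3 ^ n) \<le> 1 / (2 * 3 ^ m :: real)"
    using mn by (simp add: field_simps power_increasing)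
  ultimately show ?thesis
    by simp
qed

text \<open>Coding the membership pattern in the family \<open>\<W>\<close> as a real number makes every member of
  \<open>\<W>\<close> clopen, which reduces a colouring by countably many rectangles to OCA for sets of reals.\<close>

lemma OCA_rectangles:
  fixes X :: "'i set" and Q :: "'i \<Rightarrow> 'i \<Rightarrow> bool"
  assumes OCA "uncountable X" "countable \<W>"
    and sep: "\<And>x y. \<lbrakk>x \<in> X; y \<in> X; x \<noteq> y\<rbrakk> \<Longrightarrow> \<exists>A\<in>\<W>. x \<in> A \<and> y \<notin> A"
    and rect: "\<And>x y. \<lbrakk>x \<in> X; y \<in> X; x \<noteq> y; Q x y\<rbrakk> \<Longrightarrow>
       \<exists>A\<in>\<W>. \<exists>B\<in>\<W>. x \<in> A \<and> y \<in> B \<and> (\<forall>x'\<in>A \<inter> X. \<forall>y'\<in>B \<inter> X. x' \<noteq> y' \<longrightarrow> Q x' y')"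
  obtains Y where "Y \<subseteq> X" "uncountable Y"
      "pairwise (\<lambda>x y. Q x y \<and> Q y x) Y \<or> pairwise (\<lambda>x y. \<not> (Q x y \<and> Q y x)) Y"
proof -
  define w where "w = from_nat_into \<W>"
  define \<phi> where "\<phi> x = cantor_code (\<lambda>n. x \<in> w n)" for x
  \<comment> \<open>The radius \<open>e\<close> depends on \<open>A\<close> alone, not on the
    points: it comes from the position of \<open>A\<close> in the enumeration
    \<open>w\<close>.\<close>
  have near: "\<exists>e>0. \<forall>x y. \<bar>\<phi> x - \<phi> y\<bar> < e \<longrightarrow> (x \<in> A \<longleftrightarrow> y \<in> A)" if A: "A \<in> \<W>" for A
  proof -
    obtain n where n: "A = w n"
      using from_nat_into_surj[OF \<open>countable \<W>\<close> A] unfolding w_def by blast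
    have "x \<in> A \<longleftrightarrow> y \<in> A" if "\<bar>\<phi> x - \<phi> y\<bar> < 1 / (2 * 3 ^ n)" for x y
    proof (rule ccontr)
      assume "\<not> (x \<in> A \<longleftrightarrow> y \<in> A)"
      with cantor_code_dist[of "\<lambda>n. x \<in> w n" n "\<lambda>n. y \<in> w n"] that n show False
        by (simp add: \<phi>_def)
    qed
    then show ?thesis
      by (intro exI[of _ "1 / (2 * 3 ^ n)"]) simp
  qed
  have inj: "inj_on \<phi> X"
  proof (rule inj_onI, rule ccontr)
    fix x y assume *: "x \<in> X" "y \<in> X" "\<phi> x = \<phi> y" "x \<noteq> y"
    then obtain A where "A \<in> \<W>" "x \<in> A" "y \<notin> A" using sep by blast
    moreover obtain e where "e > 0" "\<And>u v. \<bar>\<phi> u - \<phi> v\<bar> < e \<Longrightarrow> u \<in> A \<longleftrightarrow> v \<in> A"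
      using near \<open>A \<in> \<W>\<close> by meson
    ultimately show False using *(3) by (metis abs_zero diff_self)
  qed
  \<comment> \<open>OCA colours unordered pairs, so the relation \<open>Q\<close> has to be
    symmetrised first.\<close>
  define R where "R x y \<longleftrightarrow> Q x y \<and> Q y x" for x y
  define K0 where "K0 = {{\<phi> x, \<phi> y} | x y. x \<in> X \<and> y \<in> X \<and> x \<noteq> y \<and> R x y}"
  have K0_iff: "{\<phi> x, \<phi> y} \<in> K0 \<longleftrightarrow> x \<noteq> y \<and> R x y" if "x \<in> X" "y \<in> X" for x y
  proof
    assume "{\<phi> x, \<phi> y} \<in> K0"
    then obtain x' y' where *: "x' \<in> X" "y' \<in> X" "x' \<noteq> y'" "R x' y'" "{\<phi> x, \<phi> y} = {\<phi> x', \<phi> y'}"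
      unfolding K0_def by auto
    then have "x = x' \<and> y = y' \<or> x = y' \<and> y = x'"
      using inj that by (auto simp: doubleton_eq_iff inj_on_eq_iff)
    with * show "x \<noteq> y \<and> R x y" unfolding R_def by blast
  qed (use that in \<open>auto simp: K0_def\<close>)
  have K0_sub: "K0 \<subseteq> pairs2 (\<phi> ` X)"
    unfolding K0_def pairs2_def using inj by (fastforce simp: inj_on_eq_iff)
  have nearQ: "\<exists>e>0. \<forall>x'\<in>X. \<forall>y'\<in>X. \<bar>\<phi> x - \<phi> x'\<bar> < e \<and> \<bar>\<phi> y - \<phi> y'\<bar> < e \<and> x' \<noteq> y' \<longrightarrow> Q x' y'"
    if xy: "x \<in> X" "y \<in> X" "x \<noteq> y" "Q x y" for x y
  proof -
    obtain A B where AB: "A \<in> \<W>" "B \<in> \<W>" "x \<in> A" "y \<in> B"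
      "\<And>x' y'. \<lbrakk>x' \<in> A; x' \<in> X; y' \<in> B; y' \<in> X; x' \<noteq> y'\<rbrakk> \<Longrightarrow> Q x' y'"
      using rect[OF xy] by blast
    obtain e1 e2 where e: "e1 > 0" "e2 > 0"
      "\<And>u v. \<bar>\<phi> u - \<phi> v\<bar> < e1 \<Longrightarrow> u \<in> A \<longleftrightarrow> v \<in> A"
      "\<And>u v. \<bar>\<phi> u - \<phi> v\<bar> < e2 \<Longrightarrow> u \<in> B \<longleftrightarrow> v \<in> B"
      using near AB(1,2) by meson
    show ?thesis
      by (rule exI[of _ "min e1 e2"]) (use AB e in auto)
  qed
  have "openin (top_of_set (\<phi> ` X \<times> \<phi> ` X)) {(u, v). u \<in> \<phi> ` X \<and> v \<in> \<phi> ` X \<and> {u, v} \<in> K0}"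
    (is "openin _ ?T")
    unfolding openin_euclidean_subtopology_iff
  proof (intro conjI ballI)
    show "?T \<subseteq> \<phi> ` X \<times> \<phi> ` X" by auto
    fix p assume "p \<in> ?T"
    then obtain x y where xy: "p = (\<phi> x, \<phi> y)" "x \<in> X" "y \<in> X" "x \<noteq> y" "R x y"
      using K0_iff by auto
    obtain e1 where e1: "e1 > 0"
      "\<And>x' y'. \<lbrakk>x' \<in> X; y' \<in> X; \<bar>\<phi> x - \<phi> x'\<bar> < e1; \<bar>\<phi> y - \<phi> y'\<bar> < e1; x' \<noteq> y'\<rbrakk> \<Longrightarrow> Q x' y'"
      using nearQ[of x y] xy unfolding R_def by meson
    obtain e2 where e2: "e2 > 0"
      "\<And>x' y'. \<lbrakk>x' \<in> X; y' \<in> X; \<bar>\<phi> y - \<phi> x'\<bar> < e2; \<bar>\<phi> x - \<phi> y'\<bar> < e2; x' \<noteq> y'\<rbrakk> \<Longrightarrow> Q x' y'"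
      using nearQ[of y x] xy unfolding R_def by metis
    obtain A where A: "A \<in> \<W>" "x \<in> A" "y \<notin> A" using sep xy by blast
    \<comment> \<open>Rectangles control \<open>Q\<close> only off the diagonal. The set
      \<open>A\<close> separates \<open>x\<close> from \<open>y\<close>, so \<open>e3\<close> keeps
      nearby pairs distinct as well.\<close>
    obtain e3 where e3: "e3 > 0" "\<And>u v. \<bar>\<phi> u - \<phi> v\<bar> < e3 \<Longrightarrow> u \<in> A \<longleftrightarrow> v \<in> A"
      using near A(1) by meson
    show "\<exists>e>0. \<forall>q\<in>\<phi> ` X \<times> \<phi> ` X. dist q p < e \<longrightarrow> q \<in> ?T"
    proof (intro exI conjI ballI impI)
      show "min e1 (min e2 e3) > 0" using e1 e2 e3 by simp
      fix q assume "q \<in> \<phi> ` X \<times> \<phi> ` X" and d: "dist q p < min e1 (min e2 e3)"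
      then obtain x' y' where q: "q = (\<phi> x', \<phi> y')" "x' \<in> X" "y' \<in> X" by auto
      have "dist (fst q) (fst p) < min e1 (min e2 e3)" "dist (snd q) (snd p) < min e1 (min e2 e3)"
        using d dist_fst_le[of q p] dist_snd_le[of q p] by linarith+
      then have lt: "\<bar>\<phi> x - \<phi> x'\<bar> < min e1 (min e2 e3)" "\<bar>\<phi> y - \<phi> y'\<bar> < min e1 (min e2 e3)"
        by (simp_all add: q xy dist_real_def abs_minus_commute)
      then have "x' \<noteq> y'" using e3(2) A by (metis min_less_iff_conj)
      then have "R x' y'" unfolding R_def using e1(2) e2(2) q lt by auto
      then show "q \<in> ?T" using q K0_iff \<open>x' \<noteq> y'\<close> by auto
    qed
  qed
  with K0_sub have "(\<exists>Z\<subseteq>\<phi> ` X. uncountable Z \<and> pairs2 Z \<subseteq> K0) \<or>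
      (\<exists>Xn :: nat \<Rightarrow> real set. \<phi> ` X = (\<Union>n. Xn n) \<and>
        (\<forall>n. pairs2 (Xn n) \<subseteq> pairs2 (\<phi> ` X) - K0))"
    by (intro \<open>OCA\<close>[unfolded OCA_def, rule_format] conjI)
  moreover have pairs: "{\<phi> x, \<phi> y} \<in> pairs2 (\<phi> ` Y)"
    if "Y \<subseteq> X" "x \<in> Y" "y \<in> Y" "x \<noteq> y" for x y Y
  proof -
    have "\<phi> x \<noteq> \<phi> y" using inj that by (auto dest: inj_onD)
    with that show ?thesis unfolding pairs2_def by blast
  qed
  ultimately show ?thesis
  proof (elim disjE exE conjE)
    fix Z assume hom: "Z \<subseteq> \<phi> ` X" "uncountable Z" "pairs2 Z \<subseteq> K0"
    then obtain Y where Y: "Y \<subseteq> X" "Z = \<phi> ` Y" by (meson subset_imageE)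
    have "pairwise (\<lambda>x y. Q x y \<and> Q y x) Y"
    proof (rule pairwiseI)
      fix x y assume *: "x \<in> Y" "y \<in> Y" "x \<noteq> y"
      then have "{\<phi> x, \<phi> y} \<in> pairs2 Z"
        using Y pairs by simp
      then show "Q x y \<and> Q y x" using hom(3) K0_iff[of x y] * Y unfolding R_def by blast
    qed
    moreover have "uncountable Y" using Y(2) hom(2) by auto
    ultimately show ?thesis using that Y(1) by blast
  next
    fix Xn :: "nat \<Rightarrow> real set"
    assume cover: "\<phi> ` X = (\<Union>n. Xn n)" "\<forall>n. pairs2 (Xn n) \<subseteq> pairs2 (\<phi> ` X) - K0"
    \<comment> \<open>In the second alternative of OCA, countably many homogeneous pieces cover an
      uncountable set, so one piece is uncountable.\<close>
    have "\<exists>n. uncountable (Xn n)"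
    proof (rule ccontr)
      assume "\<not> ?thesis"
      then have "countable (\<phi> ` X)" unfolding cover(1) by blast
      with \<open>uncountable X\<close> inj show False using countable_image_inj_on by blast
    qed
    then obtain n where n: "uncountable (Xn n)" ..
    obtain Y where Y: "Y \<subseteq> X" "Xn n = \<phi> ` Y"
      using UN_upper[of n UNIV Xn] unfolding cover(1)[symmetric] by (auto elim!: subset_imageE)
    have "pairwise (\<lambda>x y. \<not> (Q x y \<and> Q y x)) Y"
    proof (rule pairwiseI)
      fix x y assume *: "x \<in> Y" "y \<in> Y" "x \<noteq> y"
      then have "{\<phi> x, \<phi> y} \<in> pairs2 (Xn n)"
        using Y pairs by simp
      then show "\<not> (Q x y \<and> Q y x)" using cover(2) K0_iff[of x y] * Y unfolding R_def by blast
    qed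
    moreover have "uncountable Y" using Y(2) n by auto
    ultimately show ?thesis using that Y(1) by blast
  qed
qed

section \<open>Clopen sets in compact metrizable spaces\<close>

text \<open>Total boundedness provides a finite net for every radius 1/(n+1); the balls of these
  radii around the net points form a countable base.\<close>

lemma compact_metrizable_imp_second_countable:
  assumes "compact_space X" "metrizable_space X"
  shows "second_countable X"
proof -
  obtain S d where "Metric_space S d" and X: "X = Metric_space.mtopology S d"
    using assms(2) unfolding metrizable_space_def by blast
  interpret Metric_space S d by fact
  have "\<exists>K. finite K \<and> K \<subseteq> S \<and> S \<subseteq> (\<Union>x\<in>K. mball x (1 / Suc n))" for n
    using assms(1) compact_space_eq_mcomplete_mtotally_bounded[unfolded mtotally_bounded_def]
    unfolding X by (metis of_nat_0_less_iff zero_less_Suc zero_less_divide_1_iff)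
  then obtain K where K: "\<And>n. finite (K n)" "\<And>n. K n \<subseteq> S"
      "\<And>n. S \<subseteq> (\<Union>x\<in>K n. mball x (1 / Suc n))"
    by metis
  define \<B> where "\<B> = (\<Union>n. (\<lambda>x. mball x (1 / Suc n)) ` K n)"
  have "\<exists>V\<in>\<B>. x \<in> V \<and> V \<subseteq> U" if "openin mtopology U" "x \<in> U" for U x
  proof -
    obtain e where e: "e > 0" "mball x e \<subseteq> U" "x \<in> S"
      using \<open>openin mtopology U\<close> \<open>x \<in> U\<close> unfolding openin_mtopology by blast
    obtain n where n: "1 / Suc n < e / 2"
      using e(1) by (metis half_gt_zero nat_approx_posE)
    obtain y where y: "y \<in> K n" "x \<in> mball y (1 / Suc n)" using K(3)[of n] e(3) by auto
    have "mball y (1 / Suc n) \<subseteq> mball x e"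
    proof
      fix z assume z: "z \<in> mball y (1 / Suc n)"
      have "d x z \<le> d y x + d y z"
        using y z by (metis in_mball commute triangle)
      then show "z \<in> mball x e" using y z n by (auto simp: in_mball)
    qed
    with y e show ?thesis unfolding \<B>_def by blast
  qed
  moreover have "countable \<B>" "\<forall>V\<in>\<B>. openin mtopology V"
    unfolding \<B>_def using K(1) by (auto simp: countable_finite)
  ultimately show ?thesis unfolding second_countable_def X by blast
qed

text \<open>A clopen set is open and compact, hence a finite union of members of a countable base,
  and such a base has only countably many finite subfamilies.\<close>

lemma countable_clopen:
  assumes "compact_space X" "second_countable X"
  shows "countable {D. openin X D \<and> closedin X D}"
proof -
  obtain \<B> where \<B>: "countable \<B>" "\<And>V. V \<in> \<B> \<Longrightarrow> openin X V"
    "\<And>U x. \<lbrakk>openin X U; x \<in> U\<rbrakk> \<Longrightarrow> \<exists>V\<in>\<B>. x \<in> V \<and> V \<subseteq> U"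
    using assms(2) unfolding second_countable_def by metis
  have "{D. openin X D \<and> closedin X D} \<subseteq> \<Union> ` {\<F>. finite \<F> \<and> \<F> \<subseteq> \<B>}"
  proof clarify
    fix D assume D: "openin X D" "closedin X D"
    then have "compactin X D" using assms(1) closedin_compact_space by blast
    moreover have "\<And>V. V \<in> {V \<in> \<B>. V \<subseteq> D} \<Longrightarrow> openin X V" "D \<subseteq> \<Union>{V \<in> \<B>. V \<subseteq> D}"
      using \<B>(2,3) D(1) by blast+
    ultimately obtain \<F> where "finite \<F>" "\<F> \<subseteq> {V \<in> \<B>. V \<subseteq> D}" "D \<subseteq> \<Union>\<F>"
      unfolding compactin_def by meson
    then show "D \<in> \<Union> ` {\<F>. finite \<F> \<and> \<F> \<subseteq> \<B>}" by (intro image_eqI[of _ _ \<F>]) auto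
  qed
  moreover have "countable {\<F>. finite \<F> \<and> \<F> \<subseteq> \<B>}"
    using countable_Collect_finite_subset[OF \<B>(1)] .
  ultimately show ?thesis by (meson countable_image countable_subset)
qed

section \<open>A totally disconnected nonmetrizable quotient\<close>

text \<open>Identifying points with the same \<open>\<sigma>\<close>-values gives a copy of the
  image of \<open>X\<close> in {0,1}^Y. Its coordinate sets are clopen and separate points. By
  \<open>indep\<close> they are pairwise distinct, so there are too many clopen sets for a compact
  metrizable space. Taking equivalence classes as points places \<open>L\<close> on the type
  \<open>'c set\<close>.\<close>

lemma nonmetrizable_totally_disconnected_quotient:
  fixes X :: "'c topology" and \<sigma> :: "'i \<Rightarrow> 'c \<Rightarrow> bool"
  assumes "compact_space X" "uncountable Y"
    and cont: "\<And>\<xi>. \<xi> \<in> Y \<Longrightarrow> continuous_map X (discrete_topology UNIV) (\<sigma> \<xi>)"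
    and indep: "\<And>\<xi>. \<xi> \<in> Y \<Longrightarrow> \<exists>p\<in>topspace X. \<exists>q\<in>topspace X.
       \<sigma> \<xi> p \<noteq> \<sigma> \<xi> q \<and> (\<forall>\<eta>\<in>Y - {\<xi>}. \<sigma> \<eta> p = \<sigma> \<eta> q)"
  obtains L :: "'c set topology" and g where
    "continuous_map X L g" "g ` topspace X = topspace L" "compact_space L" "Hausdorff_space L"
    "totally_disconnected_space L" "\<not> metrizable_space L"
proof -
  define g where "g p = {q \<in> topspace X. \<forall>\<eta>\<in>Y. \<sigma> \<eta> q = \<sigma> \<eta> p}" for p
  \<comment> \<open>This is the quotient topology induced by \<open>g\<close>.\<close>
  define L where "L = topology (\<lambda>U. U \<subseteq> g ` topspace X \<and> openin X {x \<in> topspace X. g x \<in> U})"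
  have "istopology (\<lambda>U. U \<subseteq> g ` topspace X \<and> openin X {x \<in> topspace X. g x \<in> U})"
    unfolding istopology_def
  proof (intro conjI allI impI)
    fix S T assume "S \<subseteq> g ` topspace X \<and> openin X {x \<in> topspace X. g x \<in> S}"
      "T \<subseteq> g ` topspace X \<and> openin X {x \<in> topspace X. g x \<in> T}"
    moreover have "{x \<in> topspace X. g x \<in> S \<inter> T}
        = {x \<in> topspace X. g x \<in> S} \<inter> {x \<in> topspace X. g x \<in> T}" by auto
    ultimately show "S \<inter> T \<subseteq> g ` topspace X" "openin X {x \<in> topspace X. g x \<in> S \<inter> T}"
      by auto
  next
    fix \<K> assume "\<forall>U\<in>\<K>. U \<subseteq> g ` topspace X \<and> openin X {x \<in> topspace X. g x \<in> U}"
    moreover have "{x \<in> topspace X. g x \<in> \<Union>\<K>} = (\<Union>U\<in>\<K>. {x \<in> topspace X. g x \<in> U})" by auto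
    ultimately show "\<Union>\<K> \<subseteq> g ` topspace X" "openin X {x \<in> topspace X. g x \<in> \<Union>\<K>}"
      by auto
  qed
  then have openL: "openin L U \<longleftrightarrow> U \<subseteq> g ` topspace X \<and> openin X {x \<in> topspace X. g x \<in> U}" for U
    unfolding L_def by (simp add: topology_inverse')
  have "openin L (g ` topspace X)"
    unfolding openL by (auto intro: back_subst[of "openin X", OF openin_topspace])
  then have topL: "topspace L = g ` topspace X"
    using openL by (metis openin_subset openin_topspace subset_antisym)
  have g_cont: "continuous_map X L g"
    unfolding continuous_map_def by (auto simp: topL openL)
  then have compL: "compact_space L"
    using image_compactin[of X "topspace X" L g] assms(1) by (simp add: compact_space_def topL)
  \<comment> \<open>As \<open>\<sigma> \<xi>\<close> is constant on each class, one witness in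
    \<open>E\<close> speaks for all of \<open>E\<close>; \<open>D \<xi>\<close> is the coordinate
    set at \<open>\<xi>\<close>.\<close>
  define D where "D \<xi> = {E \<in> topspace L. \<exists>p\<in>E. \<sigma> \<xi> p}" for \<xi>
  have gD: "g p \<in> D \<xi> \<longleftrightarrow> \<sigma> \<xi> p" if "p \<in> topspace X" "\<xi> \<in> Y" for p \<xi>
    using that by (auto simp: D_def topL g_def)
  have openX: "openin X {x \<in> topspace X. \<sigma> \<xi> x \<in> W}" if "\<xi> \<in> Y" for \<xi> W
    using cont[OF that] by (auto simp: continuous_map_def)
  have openD: "openin L (D \<xi>)" if "\<xi> \<in> Y" for \<xi>
  proof -
    have "{x \<in> topspace X. g x \<in> D \<xi>} = {x \<in> topspace X. \<sigma> \<xi> x \<in> {True}}"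
      using gD that by auto
    then show ?thesis using openX[OF that, of "{True}"] unfolding openL by (auto simp: D_def topL)
  qed
  have openDc: "openin L (topspace L - D \<xi>)" if "\<xi> \<in> Y" for \<xi>
  proof -
    have "{x \<in> topspace X. g x \<in> topspace L - D \<xi>} = {x \<in> topspace X. \<sigma> \<xi> x \<in> {False}}"
      using gD that by (auto simp: topL)
    then show ?thesis using openX[OF that, of "{False}"] unfolding openL by (auto simp: topL)
  qed
  have closedD: "closedin L (D \<xi>)" if "\<xi> \<in> Y" for \<xi>
    using openDc[OF that] by (auto simp: closedin_def D_def)
  have sepD: "\<exists>\<xi>\<in>Y. E \<in> D \<xi> \<longleftrightarrow> E' \<notin> D \<xi>" if "E \<in> topspace L" "E' \<in> topspace L" "E \<noteq> E'" for E E'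
  proof -
    obtain p q where pq: "p \<in> topspace X" "q \<in> topspace X" "E = g p" "E' = g q"
      using \<open>E \<in> topspace L\<close> \<open>E' \<in> topspace L\<close> topL by auto
    then have "\<exists>\<eta>\<in>Y. \<sigma> \<eta> p \<noteq> \<sigma> \<eta> q" using \<open>E \<noteq> E'\<close> by (auto simp: g_def)
    then show ?thesis using pq gD by auto
  qed
  have "Hausdorff_space L"
    unfolding Hausdorff_space_def
  proof (intro allI impI, elim conjE)
    fix E E' assume E: "E \<in> topspace L" "E' \<in> topspace L" "E \<noteq> E'"
    obtain \<xi> where \<xi>: "\<xi> \<in> Y" "E \<in> D \<xi> \<longleftrightarrow> E' \<notin> D \<xi>" using sepD[OF E] by blast
    show "\<exists>U V. openin L U \<and> openin L V \<and> E \<in> U \<and> E' \<in> V \<and> disjnt U V"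
    proof (cases "E \<in> D \<xi>")
      case True
      then show ?thesis using openD openDc \<xi> E
        by (intro exI[of _ "D \<xi>"] exI[of _ "topspace L - D \<xi>"]) (auto simp: disjnt_def)
    next
      case False
      then show ?thesis using openD openDc \<xi> E
        by (intro exI[of _ "topspace L - D \<xi>"] exI[of _ "D \<xi>"]) (auto simp: disjnt_def)
    qed
  qed
  moreover have "totally_disconnected_space L"
    unfolding totally_disconnected_space_def
  proof (intro allI impI)
    fix S assume S: "connectedin L S"
    have "E = E'" if "E \<in> S" "E' \<in> S" for E E'
    proof (rule ccontr)
      assume "E \<noteq> E'"
      moreover have "E \<in> topspace L" "E' \<in> topspace L"
        using that connectedin_subset_topspace[OF S] by auto
      ultimately obtain \<xi> where \<xi>: "\<xi> \<in> Y" "E \<in> D \<xi> \<longleftrightarrow> E' \<notin> D \<xi>"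
        using sepD by blast
      have "S \<subseteq> D \<xi> \<or> disjnt S (D \<xi>)"
        using connectedin_clopen_cases[OF S closedD openD] \<xi> by blast
      with \<xi> that show False by (auto simp: disjnt_def)
    qed
    then show "\<exists>a. S \<subseteq> {a}" by blast
  qed
  moreover have "\<not> metrizable_space L"
  proof
    assume "metrizable_space L"
    with compL have "countable {U. openin L U \<and> closedin L U}"
      by (simp add: compact_metrizable_imp_second_countable countable_clopen)
    then have "countable (D ` Y)"
      by (rule countable_subset[rotated]) (use openD closedD in auto)
    moreover have "inj_on D Y"
    proof (rule inj_onI, rule ccontr)
      fix \<xi> \<eta> assume *: "\<xi> \<in> Y" "\<eta> \<in> Y" "D \<xi> = D \<eta>" "\<xi> \<noteq> \<eta>"
      \<comment> \<open>If \<open>D \<xi>\<close> and \<open>D \<eta>\<close> were equal,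
        \<open>\<sigma> \<xi>\<close> and \<open>\<sigma> \<eta>\<close> would agree on
        \<open>X\<close>; but only the former distinguishes \<open>p\<close> from
        \<open>q\<close>.\<close>
      obtain p q where pq: "p \<in> topspace X" "q \<in> topspace X" "\<sigma> \<xi> p \<noteq> \<sigma> \<xi> q" "\<sigma> \<eta> p = \<sigma> \<eta> q"
        using indep[OF *(1)] * by blast
      then show False using gD * by metis
    qed
    ultimately show False using \<open>uncountable Y\<close> countable_image_inj_on by blast
  qed
  ultimately show ?thesis using that g_cont topL compL by metis
qed

section \<open>Compactness of the split space\<close>

text \<open>This replaces the two kinds of points by one condition per index. Over
  \<open>r \<xi>\<close> the condition at \<open>\<xi>\<close> is void, which frees exactly that
  coordinate because \<open>r\<close> is injective.\<close>

lemma split_points_eq: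
  assumes "split_data I M Ks r f"
  shows "split_points I M Ks r f =
    {p \<in> topspace (prod_topology M (product_topology Ks I)). \<forall>\<eta>\<in>I. fst p \<noteq> r \<eta> \<longrightarrow> snd p \<eta> = f \<eta> (fst p)}"
    (is "_ = ?S")
proof -
  have r: "r ` I \<subseteq> topspace M" "inj_on r I"
    and f: "\<And>\<eta> x. \<lbrakk>\<eta> \<in> I; x \<in> topspace M; x \<noteq> r \<eta>\<rbrakk> \<Longrightarrow> f \<eta> x \<in> topspace (Ks \<eta>)"
    using assms unfolding split_data_def continuous_map_def by auto
  then have f': "f \<eta> x \<in> topspace (Ks \<eta>)" if "\<eta> \<in> I" "x \<in> topspace M" "x \<notin> r ` I" for \<eta> x
    using that by blast
  show ?thesis
  proof (intro equalityI subsetI)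
    fix p assume "p \<in> split_points I M Ks r f"
    then show "p \<in> ?S"
      unfolding split_points_def using r f f'
      by (auto simp: PiE_iff inj_on_eq_iff)
  next
    fix p assume p: "p \<in> ?S"
    obtain x y where xy: "p = (x, y)" by (cases p)
    have x: "x \<in> topspace M" and y: "y \<in> extensional I" "\<And>\<eta>. \<eta> \<in> I \<Longrightarrow> y \<eta> \<in> topspace (Ks \<eta>)"
      and eq: "\<And>\<eta>. \<lbrakk>\<eta> \<in> I; x \<noteq> r \<eta>\<rbrakk> \<Longrightarrow> y \<eta> = f \<eta> x"
      using p by (auto simp: xy PiE_iff)
    show "p \<in> split_points I M Ks r f"
    proof (cases "x \<in> r ` I")
      case True
      then obtain \<xi> where \<xi>: "\<xi> \<in> I" "x = r \<xi>" by auto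
      have "y = restrict (\<lambda>\<eta>. if \<eta> = \<xi> then y \<xi> else f \<eta> (r \<xi>)) I"
        using y(1) eq \<xi> r(2) by (intro extensionalityI[of _ I]) (auto simp: inj_on_eq_iff)
      with \<xi> y(2) show ?thesis unfolding xy split_points_def by blast
    next
      case False
      then have "y = restrict (\<lambda>\<eta>. f \<eta> x) I"
        using y(1) eq by (intro extensionalityI[of _ I]) auto
      with False x show ?thesis unfolding xy split_points_def by blast
    qed
  qed
qed

text \<open>Each condition is closed: a violation happens over the open set where
  \<open>fst p\<close> differs from \<open>r \<eta>\<close>, and there it says that two continuous
  maps into a Hausdorff space disagree. The split is therefore closed in a compact product.\<close>

lemma compact_split_space:
  assumes "split_data I M Ks r f"
  shows "compact_space (split_space I M Ks r f)"
proof -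
  define P where "P = prod_topology M (product_topology Ks I)"
  have M: "compact_space M" "Hausdorff_space M"
    and K: "\<And>\<xi>. \<xi> \<in> I \<Longrightarrow> compact_space (Ks \<xi>)" "\<And>\<xi>. \<xi> \<in> I \<Longrightarrow> Hausdorff_space (Ks \<xi>)"
    and r: "r ` I \<subseteq> topspace M"
    and f: "\<And>\<xi>. \<xi> \<in> I \<Longrightarrow> continuous_map (subtopology M (topspace M - {r \<xi>})) (Ks \<xi>) (f \<xi>)"
    using assms unfolding split_data_def by auto
  have compP: "compact_space P"
    unfolding P_def by (simp add: compact_space_prod_topology compact_space_product_topology M K)
  have closed: "closedin P {p \<in> topspace P. fst p \<noteq> r \<eta> \<longrightarrow> snd p \<eta> = f \<eta> (fst p)}"
    if \<eta>: "\<eta> \<in> I" for \<eta>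
  proof -
    have fstP: "continuous_map P M fst"
      unfolding P_def by (rule continuous_map_fst)
    define W where "W = {p \<in> topspace P. fst p \<in> topspace M - {r \<eta>}}"
    have opM: "openin M (topspace M - {r \<eta>})"
      using M(2) \<eta> r by (simp add: closedin_Hausdorff_singleton image_subset_iff openin_diff)
    then have openW: "openin P W"
      unfolding W_def by (rule openin_continuous_map_preimage[OF fstP])
    have WP: "topspace (subtopology P W) = W" using openin_subset[OF openW] by auto
    have "continuous_map (subtopology P W) (subtopology M (topspace M - {r \<eta>})) fst"
      using fstP by (auto simp: continuous_map_in_subtopology continuous_map_from_subtopology W_def)
    then have 1: "continuous_map (subtopology P W) (Ks \<eta>) (\<lambda>p. f \<eta> (fst p))"
      using continuous_map_compose[OF _ f[OF \<eta>]] by (simp add: o_def)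
    have "continuous_map P (product_topology Ks I) snd"
      unfolding P_def by (rule continuous_map_snd)
    then have "continuous_map P (Ks \<eta>) (\<lambda>p. snd p \<eta>)"
      using continuous_map_compose[OF _ continuous_map_product_projection[OF \<eta>]]
      by (fastforce simp: o_def)
    then have 2: "continuous_map (subtopology P W) (Ks \<eta>) (\<lambda>p. snd p \<eta>)"
      by (rule continuous_map_from_subtopology)
    have "closedin (subtopology P W) {p \<in> topspace (subtopology P W). snd p \<eta> = f \<eta> (fst p)}"
      by (rule closedin_continuous_maps_eq[OF K(2)[OF \<eta>] 2 1])
    then have "openin (subtopology P W) (W - {p \<in> W. snd p \<eta> = f \<eta> (fst p)})"
      unfolding closedin_def WP by (rule conjunct2)
    then have "openin P (W - {p \<in> W. snd p \<eta> = f \<eta> (fst p)})"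
      using openW openin_trans_full by blast
    then have "closedin P (topspace P - (W - {p \<in> W. snd p \<eta> = f \<eta> (fst p)}))"
      by (rule closedin_diff[OF closedin_topspace])
    moreover have "topspace P - (W - {p \<in> W. snd p \<eta> = f \<eta> (fst p)})
        = {p \<in> topspace P. fst p \<noteq> r \<eta> \<longrightarrow> snd p \<eta> = f \<eta> (fst p)}"
      by (auto simp: W_def P_def)
    ultimately show ?thesis by simp
  qed
  \<comment> \<open>The factor \<open>topspace P\<close> covers the case of empty \<open>I\<close>,
    where the bare intersection would be the whole type.\<close>
  have "closedin P (topspace P \<inter> \<Inter>((\<lambda>\<eta>. {p \<in> topspace P. fst p \<noteq> r \<eta> \<longrightarrow> snd p \<eta> = f \<eta> (fst p)}) ` I))"
    using closed by (cases "I = {}") (auto intro!: closedin_Int closedin_Inter)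
  also have "topspace P \<inter> \<Inter>((\<lambda>\<eta>. {p \<in> topspace P. fst p \<noteq> r \<eta> \<longrightarrow> snd p \<eta> = f \<eta> (fst p)}) ` I)
      = split_points I M Ks r f"
    unfolding split_points_eq[OF assms] P_def[symmetric] by auto
  finally have "compactin P (split_points I M Ks r f)"
    using compP closedin_compact_space by blast
  then show ?thesis
    unfolding split_space_def P_def[symmetric] by (rule compact_space_subtopology)
qed

section \<open>A common gap obtained from OCA\<close>

text \<open>Avoiding a closed interval is an open condition, so OCA applies. Its other alternative
  says only that at least one of the two values of each pair lies in the interval; three disjoint
  intervals tried on shrinking sets rule out that this happens every time.\<close>

lemma OCA_homogeneous_gap:
  fixes g :: "'i \<Rightarrow> 'a \<Rightarrow> real"
  assumes OCA "uncountable X" "second_countable M" "Hausdorff_space M"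
    and r: "r ` X \<subseteq> topspace M" "inj_on r X"
    and g: "\<And>\<xi>. \<xi> \<in> X \<Longrightarrow> continuous_map (subtopology M (topspace M - {r \<xi>})) euclideanreal (g \<xi>)"
  obtains Y a b where "Y \<subseteq> X" "uncountable Y" "0 < a" "a < b" "b < 1"
    "pairwise (\<lambda>\<xi> \<eta>. g \<eta> (r \<xi>) \<notin> {a..b}) Y"
proof -
  obtain \<B> where \<B>: "countable \<B>" "\<And>V. V \<in> \<B> \<Longrightarrow> openin M V"
    "\<And>U x. \<lbrakk>openin M U; x \<in> U\<rbrakk> \<Longrightarrow> \<exists>V\<in>\<B>. x \<in> V \<and> V \<subseteq> U"
    using \<open>second_countable M\<close> unfolding second_countable_def by metis
  have opM: "openin M (topspace M - {r \<eta>})" if "\<eta> \<in> X" for \<eta>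
    using \<open>Hausdorff_space M\<close> r(1) that
    by (simp add: closedin_Hausdorff_singleton image_subset_iff openin_diff)
  have step: "\<exists>Y\<subseteq>Z. uncountable Y \<and>
      (pairwise (\<lambda>\<xi> \<eta>. g \<eta> (r \<xi>) \<notin> {a..b} \<and> g \<xi> (r \<eta>) \<notin> {a..b}) Y \<or>
       pairwise (\<lambda>\<xi> \<eta>. \<not> (g \<eta> (r \<xi>) \<notin> {a..b} \<and> g \<xi> (r \<eta>) \<notin> {a..b})) Y)"
    if Z: "Z \<subseteq> X" "uncountable Z" for Z a b
  proof -
    \<comment> \<open>If \<open>x\<close> lies in \<open>A V\<close> and \<open>y\<close> in
      \<open>B V\<close>, then \<open>g y (r x)\<close> avoids the interval. So the sets
      \<open>A V\<close>, \<open>B V\<close> for basic \<open>V\<close> are the sides of the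
      rectangles; the clause on \<open>r \<eta>\<close> in \<open>B V\<close> keeps \<open>V\<close>
      inside the domain where \<open>g \<eta>\<close> is continuous.\<close>
    define A where "A V = {\<xi>. r \<xi> \<in> V}" for V
    define B where "B V = {\<eta>. r \<eta> \<notin> V \<and> (\<forall>z\<in>V. g \<eta> z \<notin> {a..b})}" for V
    define \<W> where "\<W> = A ` \<B> \<union> B ` \<B>"
    have sep: "\<exists>W\<in>\<W>. x \<in> W \<and> y \<notin> W" if "x \<in> Z" "y \<in> Z" "x \<noteq> y" for x y
    proof -
      have "r x \<in> topspace M - {r y}" "y \<in> X"
        using that Z r by (auto simp: inj_on_eq_iff subset_iff)
      then obtain V where "V \<in> \<B>" "r x \<in> V" "V \<subseteq> topspace M - {r y}"
        using \<B>(3) opM by meson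
      then show ?thesis
        by (intro bexI[of _ "A V"]) (auto simp: A_def \<W>_def)
    qed
    have rect: "\<exists>U\<in>\<W>. \<exists>W\<in>\<W>. x \<in> U \<and> y \<in> W \<and>
        (\<forall>x'\<in>U \<inter> Z. \<forall>y'\<in>W \<inter> Z. x' \<noteq> y' \<longrightarrow> g y' (r x') \<notin> {a..b})"
      if "x \<in> Z" "y \<in> Z" "x \<noteq> y" "g y (r x) \<notin> {a..b}" for x y
    proof -
      have y: "y \<in> X" and rx: "r x \<in> topspace M - {r y}"
        using that Z r by (auto simp: inj_on_eq_iff subset_iff)
      define U where "U = {z \<in> topspace M - {r y}. g y z \<in> - {a..b}}"
      have "openin (subtopology M (topspace M - {r y}))
          {z \<in> topspace (subtopology M (topspace M - {r y})). g y z \<in> - {a..b}}"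
        by (rule openin_continuous_map_preimage[OF g[OF y]]) (simp add: open_Compl)
      also have "{z \<in> topspace (subtopology M (topspace M - {r y})). g y z \<in> - {a..b}} = U"
        by (auto simp: U_def)
      finally have "openin M U"
        using opM[OF y] openin_trans_full by blast
      moreover have "r x \<in> U" using rx that(4) by (auto simp: U_def)
      ultimately obtain V where "V \<in> \<B>" "r x \<in> V" "V \<subseteq> U"
        using \<B>(3) by meson
      then show ?thesis
        by (intro bexI[of _ "A V"] bexI[of _ "B V"]) (auto simp: A_def B_def \<W>_def U_def)
    qed
    have "countable \<W>" unfolding \<W>_def using \<B>(1) by simp
    then obtain Y where "Y \<subseteq> Z" "uncountable Y"
      "pairwise (\<lambda>\<xi> \<eta>. g \<eta> (r \<xi>) \<notin> {a..b} \<and> g \<xi> (r \<eta>) \<notin> {a..b}) Y \<or>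
       pairwise (\<lambda>\<xi> \<eta>. \<not> (g \<eta> (r \<xi>) \<notin> {a..b} \<and> g \<xi> (r \<eta>) \<notin> {a..b})) Y"
      using OCA_rectangles[OF \<open>OCA\<close> Z(2), of \<W> "\<lambda>x y. g y (r x) \<notin> {a..b}"] sep rect by blast
    then show ?thesis by blast
  qed
  define free where "free a b Y \<longleftrightarrow> pairwise (\<lambda>\<xi> \<eta>. g \<eta> (r \<xi>) \<notin> {a..b} \<and> g \<xi> (r \<eta>) \<notin> {a..b}) Y" for a b Y
  define hit where "hit a b Y \<longleftrightarrow> pairwise (\<lambda>\<xi> \<eta>. g \<eta> (r \<xi>) \<in> {a..b} \<or> g \<xi> (r \<eta>) \<in> {a..b}) Y" for a b Y
  have dichotomy: "\<exists>Y\<subseteq>Z. uncountable Y \<and> (free a b Y \<or> hit a b Y)"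
    if "Z \<subseteq> X" "uncountable Z" for Z a b
    using step[OF that, of a b] unfolding free_def hit_def by simp
  note gap = that
  have conclude: thesis if "Y \<subseteq> X" "uncountable Y" "0 < a" "a < b" "b < 1" "free a b Y" for Y a b
    using that(6) by (intro gap[OF that(1-5)]) (auto simp: free_def pairwise_def)
  \<comment> \<open>The multiples of 1/7 provide three disjoint closed intervals inside (0,1). Since
    the sets are nested, all three alternatives hold on \<open>Y3\<close>.\<close>
  obtain Y1 where Y1: "Y1 \<subseteq> X" "uncountable Y1" "free (1/7) (2/7) Y1 \<or> hit (1/7) (2/7) Y1"
    using dichotomy[of X "1/7" "2/7"] \<open>uncountable X\<close> by blast
  obtain Y2 where Y2: "Y2 \<subseteq> Y1" "uncountable Y2" "free (3/7) (4/7) Y2 \<or> hit (3/7) (4/7) Y2"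
    using dichotomy[of Y1 "3/7" "4/7"] Y1(1,2) by blast
  obtain Y3 where Y3: "Y3 \<subseteq> Y2" "uncountable Y3" "free (5/7) (6/7) Y3 \<or> hit (5/7) (6/7) Y3"
    using dichotomy[of Y2 "5/7" "6/7"] Y1(1) Y2(1,2) by (meson order_trans)
  \<comment> \<open>A pair contributes only two values, so it cannot meet three disjoint intervals.\<close>
  have "\<not> (hit (1/7) (2/7) Y1 \<and> hit (3/7) (4/7) Y2 \<and> hit (5/7) (6/7) Y3)"
  proof
    assume *: "hit (1/7) (2/7) Y1 \<and> hit (3/7) (4/7) Y2 \<and> hit (5/7) (6/7) Y3"
    obtain x where x: "x \<in> Y3" using Y3(2) by fastforce
    have "Y3 - {x} \<noteq> {}" using Y3(2) by (metis countable_empty uncountable_minus_countable countable_insert)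
    then obtain y where y: "y \<in> Y3" "x \<noteq> y" by blast
    have "x \<in> Y2" "y \<in> Y2" "x \<in> Y1" "y \<in> Y1" using x y Y2 Y3 by auto
    then have "g y (r x) \<in> {1/7..2/7} \<or> g x (r y) \<in> {1/7..2/7}"
      "g y (r x) \<in> {3/7..4/7} \<or> g x (r y) \<in> {3/7..4/7}"
      "g y (r x) \<in> {5/7..6/7} \<or> g x (r y) \<in> {5/7..6/7}"
      using * x y unfolding hit_def pairwise_def by blast+
    then show False by auto
  qed
  then consider "free (1/7) (2/7) Y1" | "free (3/7) (4/7) Y2" | "free (5/7) (6/7) Y3"
    using Y1(3) Y2(3) Y3(3) by blast
  then show thesis
  proof cases
    case 1 then show thesis using conclude[of Y1 "1/7" "2/7"] Y1 by simp
  next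
    case 2 then show thesis using conclude[of Y2 "3/7" "4/7", OF order_trans[OF Y2(1) Y1(1)] Y2(2)] by simp
  next
    case 3 then show thesis using conclude[of Y3 "5/7" "6/7", OF order_trans[OF order_trans[OF Y3(1) Y2(1)] Y1(1)] Y3(2)]
      by simp
  qed
qed

section \<open>Nontrivial factors and the final construction\<close>

text \<open>A product of metrizable spaces of which all but countably many have at most one point is
  metrizable, and so are its subspaces.\<close>

lemma nonmetrizable_split_imp_uncountable:
  assumes "split_data I M Ks r f" "\<not> metrizable_space (split_space I M Ks r f)"
  shows "uncountable {\<xi> \<in> I. \<not> (\<exists>a. topspace (Ks \<xi>) \<subseteq> {a})}"
proof
  assume "countable {\<xi> \<in> I. \<not> (\<exists>a. topspace (Ks \<xi>) \<subseteq> {a})}"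
  then have "metrizable_space (prod_topology M (product_topology Ks I))"
    using assms(1) unfolding split_data_def
    by (simp add: metrizable_space_prod_topology metrizable_space_product_topology)
  with assms(2) show False
    unfolding split_space_def by (simp add: metrizable_space_subtopology)
qed

theorem theorem4p7:
  fixes I :: "'i set" and M :: "'a topology" and Ks :: "'i \<Rightarrow> 'b topology"
    and r :: "'i \<Rightarrow> 'a" and f :: "'i \<Rightarrow> 'a \<Rightarrow> 'b"
  assumes "OCA"
    and "split_data I M Ks r f"
    and "\<not> metrizable_space (split_space I M Ks r f)"
  shows "\<exists>C (L :: ('a \<times> ('i \<Rightarrow> 'b)) set topology) g.
           closedin (split_space I M Ks r f) C \<and>
           continuous_map (subtopology (split_space I M Ks r f) C) L g \<and>
           g ` C = topspace L \<and>
           compact_space L \<and> Hausdorff_space L \<and>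
           totally_disconnected_space L \<and> \<not> metrizable_space L"
proof -
  define K where "K = split_space I M Ks r f"
  define J where "J = {\<xi> \<in> I. \<not> (\<exists>a. topspace (Ks \<xi>) \<subseteq> {a})}"
  have M: "compact_space M" "Hausdorff_space M" "metrizable_space M"
    and Ks: "\<And>\<xi>. \<xi> \<in> I \<Longrightarrow> Hausdorff_space (Ks \<xi>)" "\<And>\<xi>. \<xi> \<in> I \<Longrightarrow> metrizable_space (Ks \<xi>)"
    and r: "r ` I \<subseteq> topspace M" "inj_on r I"
    and f: "\<And>\<xi>. \<xi> \<in> I \<Longrightarrow> continuous_map (subtopology M (topspace M - {r \<xi>})) (Ks \<xi>) (f \<xi>)"
    using assms(2) unfolding split_data_def by auto
  have JI: "J \<subseteq> I" by (auto simp: J_def)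
  have "\<exists>h s t. continuous_map (Ks \<xi>) euclideanreal h \<and> s \<in> topspace (Ks \<xi>) \<and>
      t \<in> topspace (Ks \<xi>) \<and> h s = 0 \<and> h t = 1" if \<xi>: "\<xi> \<in> J" for \<xi>
  proof -
    have "topspace (Ks \<xi>) \<noteq> {}" using \<xi> by (auto simp: J_def)
    then obtain s where s: "s \<in> topspace (Ks \<xi>)" by blast
    then obtain t where t: "t \<in> topspace (Ks \<xi>)" "t \<noteq> s"
      using \<xi> unfolding J_def by blast
    have "closedin (Ks \<xi>) {s}" "closedin (Ks \<xi>) {t}" "normal_space (Ks \<xi>)"
      using Ks JI \<xi> s t
      by (auto simp: closedin_Hausdorff_singleton metrizable_imp_normal_space subset_iff)
    then obtain h :: "'b \<Rightarrow> real" where "continuous_map (Ks \<xi>) euclideanreal h" "h ` {s} \<subseteq> {0}" "h ` {t} \<subseteq> {1}"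
      using Urysohn_lemma_alt[of "Ks \<xi>" "{s}" "{t}" 0 1] t(2) by auto
    with s t show ?thesis by auto
  qed
  then obtain h :: "'i \<Rightarrow> 'b \<Rightarrow> real" and s t where
    h: "\<And>\<xi>. \<xi> \<in> J \<Longrightarrow> continuous_map (Ks \<xi>) euclideanreal (h \<xi>)"
    and st: "\<And>\<xi>. \<xi> \<in> J \<Longrightarrow> s \<xi> \<in> topspace (Ks \<xi>)" "\<And>\<xi>. \<xi> \<in> J \<Longrightarrow> t \<xi> \<in> topspace (Ks \<xi>)"
      "\<And>\<xi>. \<xi> \<in> J \<Longrightarrow> h \<xi> (s \<xi>) = 0" "\<And>\<xi>. \<xi> \<in> J \<Longrightarrow> h \<xi> (t \<xi>) = 1"
    by metis
  have g: "continuous_map (subtopology M (topspace M - {r \<xi>})) euclideanreal (\<lambda>x. h \<xi> (f \<xi> x))"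
    if "\<xi> \<in> J" for \<xi>
    using continuous_map_compose[OF f h] that JI by (auto simp: o_def)
  have J: "uncountable J"
    using nonmetrizable_split_imp_uncountable assms(2,3) unfolding J_def by blast
  have sc: "second_countable M"
    using M by (simp add: compact_metrizable_imp_second_countable)
  have rJ: "r ` J \<subseteq> topspace M" "inj_on r J"
    using r JI by (auto intro: inj_on_subset)
  obtain Y a b where Y: "Y \<subseteq> J" "uncountable Y" and ab: "0 < a" "a < b" "b < 1"
    and gap: "pairwise (\<lambda>\<xi> \<eta>. h \<eta> (f \<eta> (r \<xi>)) \<notin> {a..b}) Y"
    by (rule OCA_homogeneous_gap[OF assms(1) J sc M(2) rJ g])
  have hK: "continuous_map K euclideanreal (\<lambda>p. h \<xi> (snd p \<xi>))" if "\<xi> \<in> Y" for \<xi>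
  proof -
    have \<xi>: "\<xi> \<in> J" "\<xi> \<in> I" using that Y JI by auto
    have "continuous_map (prod_topology M (product_topology Ks I)) (Ks \<xi>) ((\<lambda>y. y \<xi>) \<circ> snd)"
      by (intro continuous_map_compose[OF continuous_map_snd] continuous_map_product_projection \<xi>)
    then have "continuous_map K (Ks \<xi>) ((\<lambda>y. y \<xi>) \<circ> snd)"
      unfolding K_def split_space_def by (rule continuous_map_from_subtopology)
    from continuous_map_compose[OF this h[OF \<xi>(1)]] show ?thesis by (simp add: o_def)
  qed
  \<comment> \<open>Only the open interval is removed, which makes \<open>C\<close> closed; OCA
    needed the closed interval to have an open colour.\<close>
  define C where "C = {p \<in> topspace K. \<forall>\<xi>\<in>Y. h \<xi> (snd p \<xi>) \<notin> {a<..<b}}"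
  have "Y \<noteq> {}" using Y(2) by auto
  then have "closedin K (\<Inter>\<xi>\<in>Y. {p \<in> topspace K. h \<xi> (snd p \<xi>) \<in> - {a<..<b}})"
  proof (rule closedin_INT)
    show "closedin K {p \<in> topspace K. h \<xi> (snd p \<xi>) \<in> - {a<..<b}}" if "\<xi> \<in> Y" for \<xi>
      by (rule closedin_continuous_map_preimage[OF hK[OF that]]) (simp add: closed_Compl)
  qed
  moreover have "(\<Inter>\<xi>\<in>Y. {p \<in> topspace K. h \<xi> (snd p \<xi>) \<in> - {a<..<b}}) = C"
    unfolding C_def using \<open>Y \<noteq> {}\<close> by auto
  ultimately have closedC: "closedin K C" by simp
  then have topC: "topspace (subtopology K C) = C"
    using closedin_subset by fastforce
  have compC: "compact_space (subtopology K C)"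
    using closedC compact_split_space[OF assms(2)] closedin_compact_space compact_space_subtopology
    unfolding K_def by blast
  \<comment> \<open>On \<open>C\<close> a value above \<open>a\<close> is at least \<open>b\<close>,
    so for \<open>\<xi>\<close> in \<open>Y\<close> the conditions \<open>> a\<close> and
    \<open>< b\<close> are complementary and both open.\<close>
  define \<sigma> where "\<sigma> \<xi> p \<longleftrightarrow> h \<xi> (snd p \<xi>) > a" for \<xi> and p :: "'a \<times> ('i \<Rightarrow> 'b)"
  have cont: "continuous_map (subtopology K C) (discrete_topology UNIV) (\<sigma> \<xi>)" if \<xi>: "\<xi> \<in> Y" for \<xi>
  proof -
    have hC: "continuous_map (subtopology K C) euclideanreal (\<lambda>p. h \<xi> (snd p \<xi>))"
      using hK[OF \<xi>] by (rule continuous_map_from_subtopology)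
    have "openin (subtopology K C) {p \<in> C. h \<xi> (snd p \<xi>) \<in> {a<..}}"
      "openin (subtopology K C) {p \<in> C. h \<xi> (snd p \<xi>) \<in> {..<b}}"
      using openin_continuous_map_preimage[OF hC, of "{a<..}"]
        openin_continuous_map_preimage[OF hC, of "{..<b}"] unfolding topC by simp_all
    moreover have "{p \<in> C. h \<xi> (snd p \<xi>) \<in> {a<..}} = {p \<in> C. \<sigma> \<xi> p}"
      "{p \<in> C. h \<xi> (snd p \<xi>) \<in> {..<b}} = {p \<in> C. \<not> \<sigma> \<xi> p}"
      using \<xi> ab by (auto simp: C_def \<sigma>_def not_less)
    ultimately have op: "openin (subtopology K C) {p \<in> C. \<sigma> \<xi> p}"
      "openin (subtopology K C) {p \<in> C. \<not> \<sigma> \<xi> p}"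
      by simp_all
    have "openin (subtopology K C) {p \<in> C. \<sigma> \<xi> p \<in> W}" for W
    proof -
      have "{p \<in> C. \<sigma> \<xi> p \<in> W} = (if True \<in> W then {p \<in> C. \<sigma> \<xi> p} else {}) \<union>
          (if False \<in> W then {p \<in> C. \<not> \<sigma> \<xi> p} else {})"
        by (auto; metis (full_types))
      then show ?thesis using op by (simp add: openin_Un)
    qed
    then show ?thesis unfolding continuous_map_def topC by simp
  qed
  \<comment> \<open>These are the points of the split over \<open>r \<xi>\<close>, with free
    coordinate \<open>u\<close> at \<open>\<xi>\<close>.\<close>
  define x where "x \<xi> u = (r \<xi>, restrict (\<lambda>\<eta>. if \<eta> = \<xi> then u else f \<eta> (r \<xi>)) I)" for \<xi> u
  have xK: "x \<xi> u \<in> topspace K" if "\<xi> \<in> I" "u \<in> topspace (Ks \<xi>)" for \<xi> u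
  proof -
    have "x \<xi> u \<in> split_points I M Ks r f"
      unfolding x_def split_points_def using that by blast
    then show ?thesis
      unfolding K_def split_space_def using split_points_eq[OF assms(2)] by auto
  qed
  have indep: "\<exists>p\<in>topspace (subtopology K C). \<exists>q\<in>topspace (subtopology K C).
       \<sigma> \<xi> p \<noteq> \<sigma> \<xi> q \<and> (\<forall>\<eta>\<in>Y - {\<xi>}. \<sigma> \<eta> p = \<sigma> \<eta> q)" if \<xi>: "\<xi> \<in> Y" for \<xi>
    unfolding topC
  \<comment> \<open>The two witnesses lie over the same \<open>r \<xi>\<close>. Their
    \<open>\<xi>\<close>-coordinates have heights 0 and 1, on opposite sides of the gap; at every
    other index of \<open>Y\<close> they share a coordinate whose height avoids the gap by
    homogeneity.\<close>
  proof (rule bexI[of _ "x \<xi> (s \<xi>)"], rule bexI[of _ "x \<xi> (t \<xi>)"], intro conjI ballI)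
    have in_I: "\<xi> \<in> J" "\<And>\<eta>. \<eta> \<in> Y \<Longrightarrow> \<eta> \<in> I" using \<xi> Y JI by auto
    have sndx: "snd (x \<xi> u) \<eta> = (if \<eta> = \<xi> then u else f \<eta> (r \<xi>))" if "\<eta> \<in> Y" for \<eta> u
      using in_I(2)[OF that] by (simp add: x_def)
    have gap': "h \<eta> (f \<eta> (r \<xi>)) \<notin> {a<..<b}" if "\<eta> \<in> Y" "\<eta> \<noteq> \<xi>" for \<eta>
      using gap \<xi> that unfolding pairwise_def by fastforce
    show "x \<xi> (s \<xi>) \<in> C" "x \<xi> (t \<xi>) \<in> C"
      unfolding C_def using xK st[OF in_I(1)] in_I(2)[OF \<xi>] gap' ab by (auto simp: sndx)
    show "\<sigma> \<xi> (x \<xi> (s \<xi>)) \<noteq> \<sigma> \<xi> (x \<xi> (t \<xi>))"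
      using st[OF in_I(1)] ab \<xi> by (simp add: \<sigma>_def sndx)
    show "\<sigma> \<eta> (x \<xi> (s \<xi>)) = \<sigma> \<eta> (x \<xi> (t \<xi>))" if "\<eta> \<in> Y - {\<xi>}" for \<eta>
      using that by (simp add: \<sigma>_def sndx)
  qed
  obtain L :: "('a \<times> ('i \<Rightarrow> 'b)) set topology" and g where
    "continuous_map (subtopology K C) L g" "g ` topspace (subtopology K C) = topspace L"
    "compact_space L" "Hausdorff_space L" "totally_disconnected_space L" "\<not> metrizable_space L"
    by (rule nonmetrizable_totally_disconnected_quotient[OF compC Y(2) cont indep])
  with closedC show ?thesis
    unfolding topC K_def[symmetric] by blast
qed

end
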